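(* Let $X=\mathbb{R}$, let $(\mu_\alpha)$ be a net of Radon sub-probability measures on $X$ and $(t_\alpha)$ a net in $]0,+\infty[$ converging to $0$. Put $\mathcal{S}=\{h_{\lambda,\nu}:(\lambda,\nu)\in\mathbb{R}^2\}$, and assume that $\Lambda(h_{\lambda,\nu})$ exists for all $(\lambda,\nu)\in\mathbb{R}^2$ and is finite for all pairs $(\lambda,\lambda)$ with $\lambda$ in some open interval $G$ containing $0$. If $$\mathrm{ran}\,{L_{\mid G}}'_-\cup\mathrm{ran}\,{L_{\mid G}}'_+\supset\mathrm{Dom}({\Lambda_{\mid\mathcal{S}}}^* )\cap\{l_1>-L(0)\},$$ then $(\mu_\alpha)$ satisfies a (narrow) large deviation principle with powers $(t_\alpha)$ and rate function $J={\Lambda_{\mid\mathcal{S}}}^*$. Moreover, $$J(x)={L_{\mid G}}^*(x)\quad\text{for all }x\in\mathrm{Dom}(J).$$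
   Context: For a Borel set $Y$, $\mu_\alpha^{t_\alpha}(Y)=(\mu_\alpha(Y))^{t_\alpha}$. For reals $\lambda,\nu$, $h_{\lambda,\nu}$ is the function on $\mathbb{R}$ with $h_{\lambda,\nu}(x)=\lambda x$ if $x\le 0$ and $h_{\lambda,\nu}(x)=\nu x$ if $x\ge 0$. For a continuous function $h$ on $\mathbb{R}$, $\Lambda(h)=\log\lim_\alpha\left(\int_{\mathbb{R}}e^{h(x)/t_\alpha}\mu_\alpha(dx)\right)^{t_\alpha}\in[-\infty,+\infty]$, and $\Lambda(h)$ is said to exist when this limit exists in $[0,+\infty]$ (with $\log 0=-\infty$, $\log(+\infty)=+\infty$). $L(\lambda)=\Lambda(h_{\lambda,\lambda})$. For $x\in X$, $l_1(x)=-\log\inf\{\liminf_\alpha\mu_\alpha^{t_\alpha}(V):x\in V\subset X,\ V\text{ open}\}$, and $\{l_1>c\}=\{x:l_1(x)>c\}$. When $L$ is finite on the open interval $G$, $L_{\mid G}$ is convex; ${L_{\mid G}}'_-$ and ${L_{\mid G}}'_+$ are its left and right derivatives (functions on $G$), $\mathrm{ran}$ denotes the range, and ${L_{\mid G}}^*(x)=\sup_{\lambda\in G}\{\lambda x-L(\lambda)\}$. Also ${\Lambda_{\mid\mathcal{S}}}^*(x)=\sup_{(\lambda,\nu)\in\mathbb{R}^2}\{h_{\lambda,\nu}(x)-\Lambda(h_{\lambda,\nu})\}$. For a $[-\infty,+\infty]$-valued function $f$, $\mathrm{Dom}(f)=\{f<+\infty\}$. $(\mu_\alpha)$ satisfies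 a (narrow) large deviation principle with powers $(t_\alpha)$ and rate function $J$ if $J:X\to[0,+\infty]$ is lower semi-continuous, $\limsup_\alpha\mu_\alpha^{t_\alpha}(F)\le\sup_{x\in F}e^{-J(x)}$ for all closed $F\subset X$, and $\sup_{x\in V}e^{-J(x)}\le\liminf_\alpha\mu_\alpha^{t_\alpha}(V)$ for all open $V\subset X$ (the supremum over the empty set being $0$ here). *)

theory Defs
  imports "HOL-Probability.Giry_Monad"
begin

text \<open>
  A net with index type \<open>'i\<close> is a function on \<open>'i\<close> together with a filter \<open>F \<noteq> bot\<close> (for a
  directed set: the filter generated by its tails); limits, upper and lower limits of the net are
  \<open>tendsto\<close>, \<open>Limsup\<close> and \<open>Liminf\<close> along \<open>F\<close>.
\<close>

definition radon_measure :: "'a::t2_space measure \<Rightarrow> bool" where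
  "radon_measure M \<longleftrightarrow>
     sets M = sets borel \<and>
     (\<forall>x. \<exists>U. open U \<and> x \<in> U \<and> emeasure M U < \<infinity>) \<and>
     (\<forall>B\<in>sets borel. emeasure M B = (SUP K\<in>{K. K \<subseteq> B \<and> compact K}. emeasure M K))"

definition enn_powr :: "ennreal \<Rightarrow> real \<Rightarrow> ennreal" where
  \<comment> \<open>only meaningful for exponents \<open>a > 0\<close>\<close>
  "enn_powr x a = (if x = \<infinity> then \<infinity> else ennreal (enn2real x powr a))"

definition enn_ln :: "ennreal \<Rightarrow> ereal" where
  "enn_ln x = (if x = 0 then -\<infinity> else if x = \<infinity> then \<infinity> else ereal (ln (enn2real x)))"

definition enn_exp :: "ereal \<Rightarrow> ennreal" where
  "enn_exp x = (if x = -\<infinity> then 0 else if x = \<infinity> then \<infinity> else ennreal (exp (real_of_ereal x)))"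

definition hfun :: "real \<Rightarrow> real \<Rightarrow> real \<Rightarrow> real" where
  "hfun l n x = (if x \<le> 0 then l * x else n * x)"

definition pow_measure :: "('i \<Rightarrow> 'a measure) \<Rightarrow> ('i \<Rightarrow> real) \<Rightarrow> 'a set \<Rightarrow> 'i \<Rightarrow> ennreal" where
  "pow_measure \<mu> t Y i = enn_powr (emeasure (\<mu> i) Y) (t i)"

definition pow_integral ::
  "('i \<Rightarrow> 'a measure) \<Rightarrow> ('i \<Rightarrow> real) \<Rightarrow> ('a \<Rightarrow> real) \<Rightarrow> 'i \<Rightarrow> ennreal" where
  "pow_integral \<mu> t h i = enn_powr (\<integral>\<^sup>+x. ennreal (exp (h x / t i)) \<partial>\<mu> i) (t i)"

definition Lambda_exists ::
  "'i filter \<Rightarrow> ('i \<Rightarrow> 'a measure) \<Rightarrow> ('i \<Rightarrow> real) \<Rightarrow> ('a \<Rightarrow> real) \<Rightarrow> bool" where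
  "Lambda_exists F \<mu> t h \<longleftrightarrow> (\<exists>l. (pow_integral \<mu> t h \<longlongrightarrow> l) F)"

definition Lambda ::
  "'i filter \<Rightarrow> ('i \<Rightarrow> 'a measure) \<Rightarrow> ('i \<Rightarrow> real) \<Rightarrow> ('a \<Rightarrow> real) \<Rightarrow> ereal" where
  "Lambda F \<mu> t h = enn_ln (Lim F (pow_integral \<mu> t h))"

definition Lfun :: "'i filter \<Rightarrow> ('i \<Rightarrow> real measure) \<Rightarrow> ('i \<Rightarrow> real) \<Rightarrow> real \<Rightarrow> ereal" where
  "Lfun F \<mu> t l = Lambda F \<mu> t (hfun l l)"

definition Lambda_S_conj ::
  "'i filter \<Rightarrow> ('i \<Rightarrow> real measure) \<Rightarrow> ('i \<Rightarrow> real) \<Rightarrow> real \<Rightarrow> ereal" where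
  "Lambda_S_conj F \<mu> t x = (SUP (l, n)\<in>UNIV. ereal (hfun l n x) - Lambda F \<mu> t (hfun l n))"

definition conj_on :: "real set \<Rightarrow> (real \<Rightarrow> ereal) \<Rightarrow> real \<Rightarrow> ereal" where
  "conj_on G f x = (SUP l\<in>G. ereal (l * x) - f l)"

definition l1 ::
  "'i filter \<Rightarrow> ('i \<Rightarrow> 'a::topological_space measure) \<Rightarrow> ('i \<Rightarrow> real) \<Rightarrow> 'a \<Rightarrow> ereal" where
  "l1 F \<mu> t x = - enn_ln (INF V\<in>{V. open V \<and> x \<in> V}. Liminf F (pow_measure \<mu> t V))"

definition left_deriv :: "(real \<Rightarrow> real) \<Rightarrow> real \<Rightarrow> real" where
  "left_deriv f x = (THE D. (f has_real_derivative D) (at_left x))"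

definition right_deriv :: "(real \<Rightarrow> real) \<Rightarrow> real \<Rightarrow> real" where
  "right_deriv f x = (THE D. (f has_real_derivative D) (at_right x))"

definition Dom :: "('a \<Rightarrow> ereal) \<Rightarrow> 'a set" where
  "Dom f = {x. f x < \<infinity>}"

definition lower_semicont :: "('a::topological_space \<Rightarrow> ereal) \<Rightarrow> bool" where
  "lower_semicont f \<longleftrightarrow> (\<forall>c. open {x. c < f x})"

text \<open>The suprema below are taken in \<^typ>\<open>ennreal\<close>, so that the supremum over the empty set is 0.\<close>

definition narrow_LDP ::
  "'i filter \<Rightarrow> ('i \<Rightarrow> 'a::topological_space measure) \<Rightarrow> ('i \<Rightarrow> real) \<Rightarrow> ('a \<Rightarrow> ereal) \<Rightarrow> bool" where
  "narrow_LDP F \<mu> t J \<longleftrightarrow>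
     (\<forall>x. 0 \<le> J x) \<and> lower_semicont J \<and>
     (\<forall>C. closed C \<longrightarrow> Limsup F (pow_measure \<mu> t C) \<le> (SUP x\<in>C. enn_exp (- J x))) \<and>
     (\<forall>V. open V \<longrightarrow> (SUP x\<in>V. enn_exp (- J x)) \<le> Liminf F (pow_measure \<mu> t V))"

end

theory Submission
  imports Defs
begin

text \<open>
  Write \<open>J\<close> for the conjugate \<open>Lambda_S_conj\<close>. Chebyshev's inequality bounds the mass near \<open>x\<close> from
  above and yields \<open>J \<le> l1\<close>, and also, by compactness and the exponential tightness coming from
  finiteness of \<open>L\<close> near 0, the upper bound for closed sets. Conversely, let \<open>x\<close> be a one-sided
  derivative of \<open>L\<close> at \<open>a \<in> G\<close>. Tilting by a slope \<open>q\<close> slightly beside \<open>a\<close> concentrates the net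
  near \<open>x\<close>, whence \<open>l1 x \<le> a * x - L a\<close>; no differentiability of \<open>L\<close> is needed since \<open>q\<close> may
  differ from \<open>a\<close>. If \<open>l1 x \<le> - L 0\<close> the same bound holds with \<open>a = 0\<close>. Hence
  \<open>J \<le> l1 \<le> L\<^sup>* \<le> J\<close> on the domain of \<open>J\<close>, where \<open>L\<^sup>*\<close> is the conjugate of \<open>L\<close> over \<open>G\<close>.
\<close>

section \<open>One-sided derivatives of convex functions\<close>

text \<open>Slopes of chords from \<open>a\<close> increase with the right end point, so their limit
  at \<open>a\<close> is their infimum; that infimum bounds every chord slope, which is the
  supporting line inequality.\<close>

lemma convex_on_right_deriv:
  fixes f :: "real \<Rightarrow> real"
  assumes f: "convex_on G f" and G: "open G" "a \<in> G"
  shows "(f has_real_derivative right_deriv f a) (at_right a)"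
    and "\<And>b. b \<in> G \<Longrightarrow> a < b \<Longrightarrow> f a + right_deriv f a * (b - a) \<le> f b"
proof -
  define q where "q y = (f y - f a) / (y - a)" for y
  have cv: "convex G"
    using f by (simp add: convex_on_def)
  obtain e where e: "e > 0" "ball a e \<subseteq> G"
    using G openE by blast
  have c: "a - e/2 \<in> G"
    using e by (auto simp: subset_iff dist_real_def)
  have mono: "q x \<le> q y" if "x \<in> G" "y \<in> G" "a < x" "x \<le> y" for x y
  proof (cases "x = y")
    case False
    have "(f a - f x) / (a - x) \<le> (f a - f y) / (a - y)"
      by (rule convex_on_slope_le(1)[OF f \<open>a \<in> G\<close> \<open>y \<in> G\<close>]) (use that False in auto)
    then show ?thesis
      unfolding q_def using minus_divide_divide[of "f x - f a" "x - a"] minus_divide_divide[of "f y - f a" "y - a"]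
      by simp
  qed simp
  \<comment> \<open>Openness of \<open>G\<close> gives a point of \<open>G\<close> left of
    \<open>a\<close>; its chord slope is a lower bound that keeps the infimum finite.\<close>
  have bnd: "q (a - e/2) \<le> q y" if "y \<in> G" "a < y" for y
  proof -
    have "(f (a - e/2) - f a) / ((a - e/2) - a) \<le> (f a - f y) / (a - y)"
      using convex_on_slope_le[OF f c \<open>y \<in> G\<close>, of a] that e by simp
    also have "\<dots> = q y"
      unfolding q_def by (metis minus_diff_eq minus_divide_divide)
    finally show ?thesis by (simp add: q_def)
  qed
  define D where "D = Inf (q ` ({a<..} \<inter> G))"
  have lim: "(q \<longlongrightarrow> D) (at a within ({a<..} \<inter> G))"
    unfolding D_def by (rule Lim_right_bound[where K = "q (a - e/2)"]) (use mono bnd in auto)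
  have eq: "at a within ({a<..} \<inter> G) = at_right a"
    by (rule at_within_nhd[where S = "G"]) (use G in auto)
  have D: "(f has_real_derivative D) (at_right a)"
    using lim unfolding has_field_derivative_iff eq q_def .
  moreover have "right_deriv f a = D"
    unfolding right_deriv_def
    by (rule the_equality) (auto intro: D has_field_derivative_unique)
  ultimately show "(f has_real_derivative right_deriv f a) (at_right a)"
    by simp
  fix b assume b: "b \<in> G" "a < b"
  have "D \<le> q b"
    unfolding D_def by (rule cINF_lower) (use b bnd in \<open>auto intro!: bdd_belowI2\<close>)
  then show "f a + right_deriv f a * (b - a) \<le> f b"
    using b \<open>right_deriv f a = D\<close> by (simp add: q_def le_divide_eq algebra_simps)
qed

text \<open>
  The point where the supporting line is nearly exposed is taken halfway between \<^term>\<open>a\<close> and a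
  point \<^term>\<open>a + d\<close> at which the difference quotient is close to the right derivative.
\<close>

lemma convex_on_right_deriv_exposed:
  fixes f :: "real \<Rightarrow> real"
  assumes f: "convex_on G f" and G: "open G" "a \<in> G" and x: "x = right_deriv f a" and e: "0 < e"
  shows "\<exists>p\<in>G. \<exists>q\<in>G. \<exists>r\<in>G. p < q \<and> q < r \<and> \<bar>q - a\<bar> < e \<and> f a - a * x \<le> f q - q * x \<and>
           f r - f q < (r - q) * (x + e) \<and> (q - p) * (x - e) < f q - f p"
proof -
  have "((\<lambda>y. (f y - f a) / (y - a)) \<longlongrightarrow> x) (at_right a)"
    using convex_on_right_deriv(1)[OF f G] by (simp add: has_field_derivative_iff x)
  then have "eventually (\<lambda>y. (f y - f a) / (y - a) < x + e/2) (at_right a)"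
    using e by (intro order_tendstoD) auto
  moreover have "eventually (\<lambda>y. y \<in> {a<..<a+e}) (at_right a)"
    using e by (intro eventually_at_right_real) auto
  moreover have "eventually (\<lambda>y. y \<in> G) (at_right a)"
    using G by (simp add: eventually_at_in_open' topological_tendstoD eventually_at_filter eventually_nhds) blast
  ultimately have "eventually (\<lambda>y. (f y - f a) / (y - a) < x + e/2 \<and> y \<in> {a<..<a+e} \<and> y \<in> G) (at_right a)"
    by eventually_elim auto
  then obtain r where r: "(f r - f a) / (r - a) < x + e/2" "a < r" "r < a + e" "r \<in> G"
    using eventually_happens[of _ "at_right a"] by (auto simp: trivial_limit_at_right_real)
  define q where "q = (a + r) / 2"
  have q: "a < q" "q < r" "r - a = 2 * (r - q)" "q - a = r - q"
    using r by (auto simp: q_def field_simps)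
  have qG: "q \<in> G"
    using mem_is_interval_1_I[of G a r q] f G r q
    by (auto simp: convex_on_def is_interval_convex_1)
  have 1: "f a + x * (q - a) \<le> f q"
    unfolding x by (rule convex_on_right_deriv(2)[OF f G qG q(1)])
  have "f r - f a < (x + e/2) * (r - a)"
    using r by (simp add: divide_less_eq)
  \<comment> \<open>As \<open>r - a\<close> is twice \<open>r - q\<close>, the slope error
    \<open>e/2\<close> on the whole interval becomes \<open>e\<close> on its right half.\<close>
  then have 2: "f r - f q < (r - q) * (x + e)"
    using 1 q by (simp add: algebra_simps)
  have "(q - a) * (x - e) < (q - a) * x"
    using q e by simp
  then have 3: "(q - a) * (x - e) < f q - f a"
    using 1 by (simp add: algebra_simps)
  moreover have "f a - a * x \<le> f q - q * x"
    using 1 by (simp add: algebra_simps)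
  moreover have "\<bar>q - a\<bar> < e"
    using q r by linarith
  ultimately show ?thesis
    using 2 q r qG G by (intro bexI[of _ a] bexI[of _ q] bexI[of _ r] conjI) assumption+
qed

lemma convex_on_mirror:
  fixes f :: "real \<Rightarrow> real"
  assumes "convex_on G f"
  shows "convex_on (uminus ` G) (\<lambda>y. f (- y))"
  unfolding convex_on_def
proof (intro conjI ballI allI impI)
  show "convex (uminus ` G)"
    using assms by (simp add: convex_on_def convex_negations)
  fix x y u v :: real
  assume "x \<in> uminus ` G" "y \<in> uminus ` G" "0 \<le> u" "0 \<le> v" "u + v = 1"
  then have "f (u *\<^sub>R (- x) + v *\<^sub>R (- y)) \<le> u * f (- x) + v * f (- y)"
    using assms by (auto simp: convex_on_def)
  then show "f (- (u *\<^sub>R x + v *\<^sub>R y)) \<le> u * f (- x) + v * f (- y)"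
    by (simp add: algebra_simps)
qed

lemma has_real_derivative_at_left_mirror:
  "(f has_real_derivative D) (at_left a) \<longleftrightarrow>
     ((\<lambda>y. f (- y)) has_real_derivative - D) (at_right (- a))"
proof -
  have "((\<lambda>y. (f y - f a) / (y - a)) \<longlongrightarrow> D) (at_left a) \<longleftrightarrow>
        ((\<lambda>y. - ((f (- y) - f a) / (y + a))) \<longlongrightarrow> D) (at_right (- a))"
    unfolding filterlim_at_left_to_right
    by (intro filterlim_cong refl eventuallyI) (simp add: divide_simps, simp add: algebra_simps)
  also have "\<dots> \<longleftrightarrow> ((\<lambda>y. (f (- y) - f a) / (y + a)) \<longlongrightarrow> - D) (at_right (- a))"
    by (subst tendsto_minus_cancel_left) simp
  finally show ?thesis by (simp add: has_field_derivative_iff)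
qed

text \<open>Reflection at 0 carries the results on right derivatives over to left ones.\<close>

lemma left_deriv_eq_right_deriv_mirror:
  fixes f :: "real \<Rightarrow> real"
  assumes f: "convex_on G f" and G: "open G" "a \<in> G"
  shows "left_deriv f a = - right_deriv (\<lambda>y. f (- y)) (- a)"
  unfolding left_deriv_def
proof (rule the_equality)
  have "((\<lambda>y. f (- y)) has_real_derivative right_deriv (\<lambda>y. f (- y)) (- a)) (at_right (- a))"
    by (rule convex_on_right_deriv(1)[OF convex_on_mirror[OF f]])
       (use G in \<open>auto simp: open_negations\<close>)
  then show *: "(f has_real_derivative - right_deriv (\<lambda>y. f (- y)) (- a)) (at_left a)"
    by (simp add: has_real_derivative_at_left_mirror)
  show "D = - right_deriv (\<lambda>y. f (- y)) (- a)" if "(f has_real_derivative D) (at_left a)" for D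
    using has_field_derivative_unique[OF that *] by simp
qed

lemma convex_on_left_deriv_exposed:
  fixes f :: "real \<Rightarrow> real"
  assumes f: "convex_on G f" and G: "open G" "a \<in> G" and x: "x = left_deriv f a" and e: "0 < e"
  shows "\<exists>p\<in>G. \<exists>q\<in>G. \<exists>r\<in>G. p < q \<and> q < r \<and> \<bar>q - a\<bar> < e \<and> f a - a * x \<le> f q - q * x \<and>
           f r - f q < (r - q) * (x + e) \<and> (q - p) * (x - e) < f q - f p"
proof -
  have "- x = right_deriv (\<lambda>y. f (- y)) (- a)"
    using left_deriv_eq_right_deriv_mirror[OF f G] x by simp
  from convex_on_right_deriv_exposed[OF convex_on_mirror[OF f] _ _ this e]
  obtain p q r where "p \<in> G" "q \<in> G" "r \<in> G" "- p < - q" "- q < - r" "\<bar>- q - - a\<bar> < e"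
    "f a - - a * - x \<le> f q - - q * - x" "f r - f q < (- r - - q) * (- x + e)"
    "(- q - - p) * (- x - e) < f q - f p"
    using G by (fastforce simp: open_negations)
  \<comment> \<open>Reflection reverses the order, so \<open>p\<close> and \<open>r\<close> change
    places.\<close>
  then show ?thesis
    by (intro bexI[of _ r] bexI[of _ q] bexI[of _ p]) (auto simp: algebra_simps)
qed

section \<open>Powers and logarithms in the extended half-line\<close>

text \<open>With thresholds of the form \<open>exp c\<close> the power moves to the other side, so
  that later estimates concern plain measures and integrals on the scale
  \<open>exp (c / t i)\<close>.\<close>

lemma enn_powr_less_iff:
  assumes "0 < s"
  shows "enn_powr X s < ennreal (exp c) \<longleftrightarrow> X < ennreal (exp (c / s))"
proof (cases X)
  case (real x)
  have "x powr s < exp c \<longleftrightarrow> x powr s < exp (c / s) powr s"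
    using assms by (simp add: powr_def)
  also have "\<dots> \<longleftrightarrow> x < exp (c / s)"
    using assms real by (metis exp_ge_zero linorder_not_less powr_less_mono2 powr_mono2 less_imp_le)
  finally show ?thesis
    using real by (simp add: enn_powr_def ennreal_less_iff)
qed (simp add: enn_powr_def)

lemma less_enn_powr_iff:
  assumes "0 < s"
  shows "ennreal (exp c) < enn_powr X s \<longleftrightarrow> ennreal (exp (c / s)) < X"
proof (cases X)
  case (real x)
  have "exp c < x powr s \<longleftrightarrow> exp (c / s) powr s < x powr s"
    using assms by (simp add: powr_def)
  also have "\<dots> \<longleftrightarrow> exp (c / s) < x"
    using assms real by (metis exp_ge_zero linorder_not_less powr_less_mono2 powr_mono2 less_imp_le)
  finally show ?thesis
    using real by (simp add: enn_powr_def ennreal_less_iff)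
qed (simp add: enn_powr_def)

lemma enn_powr_mono:
  assumes "0 < s" "X \<le> Y"
  shows "enn_powr X s \<le> enn_powr Y s"
  using assms
  by (cases X; cases Y) (auto simp: enn_powr_def top_unique intro!: ennreal_leI powr_mono2)

lemma enn_ln_less_iff: "enn_ln X < ereal c \<longleftrightarrow> X < ennreal (exp c)"
proof (cases X)
  case (real x)
  then show ?thesis
    by (cases "x = 0") (use exp_less_cancel_iff[of "ln x" c] exp_less_cancel_iff[of c "ln x"]
      in \<open>auto simp: enn_ln_def ennreal_less_iff\<close>)
qed (simp add: enn_ln_def)

lemma less_enn_ln_iff: "ereal c < enn_ln X \<longleftrightarrow> ennreal (exp c) < X"
proof (cases X)
  case (real x)
  then show ?thesis
    by (cases "x = 0") (use exp_less_cancel_iff[of "ln x" c] exp_less_cancel_iff[of c "ln x"]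
      in \<open>auto simp: enn_ln_def ennreal_less_iff\<close>)
qed (simp add: enn_ln_def)

lemma enn_exp_less_iff: "enn_exp x < ennreal (exp c) \<longleftrightarrow> x < ereal c"
  by (cases x) (auto simp: enn_exp_def ennreal_less_iff)

lemma enn_exp_enn_ln [simp]: "enn_exp (enn_ln X) = X"
  by (cases X) (auto simp: enn_exp_def enn_ln_def)

text \<open>A value strictly between two others is neither 0 nor infinite, hence an
  exponential.\<close>

lemma ennreal_dense_exp:
  fixes X Y :: ennreal
  assumes "X < Y"
  obtains c where "X < ennreal (exp c)" "ennreal (exp c) < Y"
proof -
  obtain Z where Z: "X < Z" "Z < Y"
    using assms dense by blast
  then obtain z where z: "Z = ennreal z" "0 \<le> z"
    by (cases Z) auto
  moreover have "z \<noteq> 0"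
    using Z z by auto
  ultimately show thesis
    using that[of "ln z"] Z by simp
qed

section \<open>Exponential bounds along the net\<close>

locale measure_net =
  fixes F :: "'i filter" and \<mu> :: "'i \<Rightarrow> 'a::topological_space measure" and t :: "'i \<Rightarrow> real"
  assumes nontrivial: "F \<noteq> bot"
    and sets_eq [measurable_cong]: "\<And>i. sets (\<mu> i) = sets borel"
    and t_pos: "\<And>i. 0 < t i"
    and t_lim: "(t \<longlongrightarrow> 0) F"
begin

lemma eventually_le_exp:
  assumes "0 < e"
  shows "\<forall>\<^sub>F i in F. K \<le> exp (e / t i)"
proof -
  \<comment> \<open>The maximum with 1 makes the constant positive, so that \<open>e / k\<close> is
    a positive threshold for \<open>t\<close>.\<close>
  define k where "k = max K 1"
  have k: "K \<le> k" "0 < k"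
    by (auto simp: k_def)
  have "\<forall>\<^sub>F i in F. t i < e / k"
    using assms t_lim k by (intro order_tendstoD) auto
  then show ?thesis
  proof eventually_elim
    case (elim i)
    then have "k < e / t i"
      using t_pos[of i] k by (simp add: field_simps)
    also have "\<dots> \<le> exp (e / t i)"
      using exp_ge_add_one_self[of "e / t i"] by linarith
    finally show ?case using k by simp
  qed
qed

text \<open>Constant factors are invisible on the exponential scale: any gap between the rates
  absorbs them.\<close>

lemma eventually_mult_exp_le:
  assumes "c < d"
  shows "\<forall>\<^sub>F i in F. K * exp (c / t i) \<le> exp (d / t i)"
proof -
  have "\<forall>\<^sub>F i in F. K \<le> exp ((d - c) / t i)"
    using assms by (intro eventually_le_exp) simp
  then show ?thesis
  proof eventually_elim
    case (elim i)
    have "K * exp (c / t i) \<le> exp ((d - c) / t i) * exp (c / t i)"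
      using elim by (intro mult_right_mono) auto
    also have "\<dots> = exp (d / t i)"
      by (simp add: exp_add[symmetric] add_divide_distrib[symmetric])
    finally show ?case .
  qed
qed

text \<open>The integral before the power is taken, restricted to a set so that it can be split into
  a ball and two tails.\<close>

definition expint :: "('a \<Rightarrow> real) \<Rightarrow> 'a set \<Rightarrow> 'i \<Rightarrow> ennreal" where
  "expint h S i = (\<integral>\<^sup>+x\<in>S. ennreal (exp (h x / t i)) \<partial>\<mu> i)"

lemma pow_integral_eq: "pow_integral \<mu> t h i = enn_powr (expint h UNIV i) (t i)"
  by (simp add: pow_integral_def expint_def)

lemma pow_integral_tendsto:
  assumes "Lambda_exists F \<mu> t h"
  shows "(pow_integral \<mu> t h \<longlongrightarrow> Lim F (pow_integral \<mu> t h)) F"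
  using assms tendsto_Lim[OF nontrivial] unfolding Lambda_exists_def by metis

lemma Lambda_lessD:
  assumes "Lambda_exists F \<mu> t h" "Lambda F \<mu> t h < ereal c"
  shows "\<forall>\<^sub>F i in F. expint h UNIV i < ennreal (exp (c / t i))"
proof -
  have "\<forall>\<^sub>F i in F. pow_integral \<mu> t h i < ennreal (exp c)"
    using assms by (intro order_tendstoD(2)[OF pow_integral_tendsto]) (auto simp: Lambda_def enn_ln_less_iff)
  then show ?thesis
    by (simp add: pow_integral_eq enn_powr_less_iff t_pos)
qed

lemma less_LambdaD:
  assumes "Lambda_exists F \<mu> t h" "ereal c < Lambda F \<mu> t h"
  shows "\<forall>\<^sub>F i in F. ennreal (exp (c / t i)) < expint h UNIV i"
proof -
  have "\<forall>\<^sub>F i in F. ennreal (exp c) < pow_integral \<mu> t h i"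
    using assms by (intro order_tendstoD(1)[OF pow_integral_tendsto]) (auto simp: Lambda_def less_enn_ln_iff)
  then show ?thesis
    by (simp add: pow_integral_eq less_enn_powr_iff t_pos)
qed

lemma Lambda_leI:
  assumes "Lambda_exists F \<mu> t h" "\<forall>\<^sub>F i in F. expint h UNIV i \<le> ennreal (exp (c / t i))"
  shows "Lambda F \<mu> t h \<le> ereal c"
proof (rule ccontr)
  assume "\<not> ?thesis"
  then have "\<forall>\<^sub>F i in F. ennreal (exp (c / t i)) < expint h UNIV i"
    using assms(1) by (intro less_LambdaD) auto
  with assms(2) have "\<forall>\<^sub>F i in F. False"
    by eventually_elim auto
  then show False
    using nontrivial by simp
qed

lemma Limsup_pow_measure_le:
  assumes "\<forall>\<^sub>F i in F. emeasure (\<mu> i) Y \<le> ennreal (exp (c / t i))"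
  shows "Limsup F (pow_measure \<mu> t Y) \<le> ennreal (exp c)"
  using assms
  by (intro Limsup_bounded) (auto elim!: eventually_mono simp: pow_measure_def less_enn_powr_iff t_pos linorder_not_less[symmetric])

lemma le_Liminf_pow_measure:
  assumes "\<forall>\<^sub>F i in F. ennreal (exp (c / t i)) \<le> emeasure (\<mu> i) Y"
  shows "ennreal (exp c) \<le> Liminf F (pow_measure \<mu> t Y)"
  using assms
  by (intro Liminf_bounded) (auto elim!: eventually_mono simp: pow_measure_def enn_powr_less_iff t_pos linorder_not_less[symmetric])

text \<open>A pointwise comparison with three uses: Chebyshev's inequality (\<open>h\<close> zero),
  change of slope on a tail, and removal of the tilt on a ball (\<open>g\<close> zero).\<close>

lemma expint_le:
  assumes [measurable]: "S \<in> sets borel" "g \<in> borel_measurable borel"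
    and le: "\<And>x. x \<in> S \<Longrightarrow> h x \<le> b + g x"
  shows "expint h S i \<le> ennreal (exp (b / t i)) * expint g S i"
proof -
  have "expint h S i \<le> (\<integral>\<^sup>+x. ennreal (exp (b / t i)) * (ennreal (exp (g x / t i)) * indicator S x) \<partial>\<mu> i)"
    unfolding expint_def
  proof (intro nn_integral_mono)
    fix x
    show "ennreal (exp (h x / t i)) * indicator S x
            \<le> ennreal (exp (b / t i)) * (ennreal (exp (g x / t i)) * indicator S x)"
      using le[of x] t_pos[of i]
      by (auto split: split_indicator simp: ennreal_mult[symmetric] exp_add[symmetric]
            add_divide_distrib[symmetric] divide_right_mono intro!: ennreal_leI)
  qed
  also have "\<dots> = ennreal (exp (b / t i)) * expint g S i"
    unfolding expint_def by (subst nn_integral_cmult) auto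
  finally show ?thesis .
qed

lemma expint_mono_set:
  assumes "S \<subseteq> T"
  shows "expint h S i \<le> expint h T i"
  unfolding expint_def using assms by (intro nn_integral_mono) (auto split: split_indicator)

lemma expint_zero: "S \<in> sets borel \<Longrightarrow> expint (\<lambda>_. 0) S i = emeasure (\<mu> i) S"
  by (simp add: expint_def sets_eq)

lemma expint_Un_le:
  assumes [measurable]: "h \<in> borel_measurable borel" "A \<in> sets borel" "B \<in> sets borel"
  shows "expint h (A \<union> B) i \<le> expint h A i + expint h B i"
proof -
  have "expint h (A \<union> B) i \<le> (\<integral>\<^sup>+x. ennreal (exp (h x / t i)) * indicator A x + ennreal (exp (h x / t i)) * indicator B x \<partial>\<mu> i)"
    unfolding expint_def by (intro nn_integral_mono) (auto split: split_indicator)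
  also have "\<dots> = expint h A i + expint h B i"
    unfolding expint_def by (intro nn_integral_add) auto
  finally show ?thesis .
qed

text \<open>Exponential Chebyshev inequality: \<open>exp ((h x - b) / t i)\<close> is at least 1 on
  the superlevel set.\<close>

lemma eventually_measure_superlevel_le:
  assumes ex: "Lambda_exists F \<mu> t h" and lt: "Lambda F \<mu> t h < ereal (b + c)"
    and [measurable]: "h \<in> borel_measurable borel"
  shows "\<forall>\<^sub>F i in F. emeasure (\<mu> i) {x. b < h x} \<le> ennreal (exp (c / t i))"
  using Lambda_lessD[OF ex lt]
proof eventually_elim
  case (elim i)
  have "emeasure (\<mu> i) {x. b < h x} = expint (\<lambda>_. 0) {x. b < h x} i"
    by (simp add: expint_zero)
  also have "\<dots> \<le> ennreal (exp (- b / t i)) * expint h {x. b < h x} i"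
    by (rule expint_le) auto
  also have "\<dots> \<le> ennreal (exp (- b / t i)) * expint h UNIV i"
    by (intro mult_left_mono expint_mono_set) auto
  also have "\<dots> \<le> ennreal (exp (- b / t i)) * ennreal (exp ((b + c) / t i))"
    using elim by (intro mult_left_mono) auto
  also have "\<dots> = ennreal (exp (c / t i))"
    by (simp add: ennreal_mult[symmetric] exp_add[symmetric] add_divide_distrib)
  finally show ?case .
qed

text \<open>A superlevel set of the continuous \<open>h\<close> is an open neighbourhood of
  \<open>x\<close> to which Chebyshev's inequality applies. This local bound feeds both the
  comparison with \<open>l1\<close> and the bound for closed sets.\<close>

lemma ex_open_measure_le:
  assumes ex: "Lambda_exists F \<mu> t h" and h: "continuous_on UNIV h"
    and lt: "ereal r < ereal (h x) - Lambda F \<mu> t h"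
  shows "\<exists>V. open V \<and> x \<in> V \<and> (\<forall>\<^sub>F i in F. emeasure (\<mu> i) V \<le> ennreal (exp (- r / t i)))"
proof -
  have "Lambda F \<mu> t h < ereal (h x - r)"
    using lt by (cases "Lambda F \<mu> t h") auto
  \<comment> \<open>The first inequality is what Chebyshev's inequality asks for; the second puts
    \<open>x\<close> into the superlevel set of level \<open>c + r\<close>.\<close>
  then obtain c where c: "Lambda F \<mu> t h < ereal c" "c < h x - r"
    by (metis ereal_dense2 ereal_less_eq(3) less_ereal.simps(1))
  have "h \<in> borel_measurable borel"
    using h by (rule borel_measurable_continuous_onI)
  with c have "\<forall>\<^sub>F i in F. emeasure (\<mu> i) {x. c + r < h x} \<le> ennreal (exp (- r / t i))"
    by (intro eventually_measure_superlevel_le ex) auto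
  moreover have "open {x. c + r < h x}"
    using h by (intro open_Collect_less continuous_intros)
  ultimately show ?thesis
    using c by (intro exI[of _ "{x. c + r < h x}"]) auto
qed

lemma conj_le_l1:
  assumes ex: "Lambda_exists F \<mu> t h" and h: "continuous_on UNIV h"
  shows "ereal (h x) - Lambda F \<mu> t h \<le> l1 F \<mu> t x"
proof (rule dense_le)
  fix y assume "y < ereal (h x) - Lambda F \<mu> t h"
  then obtain r where r: "y \<le> ereal r" "ereal r < ereal (h x) - Lambda F \<mu> t h"
    by (metis ereal_dense2 less_imp_le)
  obtain V where V: "open V" "x \<in> V" "\<forall>\<^sub>F i in F. emeasure (\<mu> i) V \<le> ennreal (exp (- r / t i))"
    using ex_open_measure_le[OF ex h r(2)] by blast
  have "(INF V\<in>{V. open V \<and> x \<in> V}. Liminf F (pow_measure \<mu> t V)) \<le> Liminf F (pow_measure \<mu> t V)"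
    using V by (intro INF_lower) auto
  also have "\<dots> \<le> ennreal (exp (- r))"
    using Liminf_le_Limsup[OF nontrivial] Limsup_pow_measure_le[OF V(3)] order_trans by blast
  finally have "\<not> ereal (- r) < enn_ln (INF V\<in>{V. open V \<and> x \<in> V}. Liminf F (pow_measure \<mu> t V))"
    by (simp add: less_enn_ln_iff not_less)
  then have "ereal r \<le> l1 F \<mu> t x"
    unfolding l1_def by (metis ereal_uminus_le_reorder not_less uminus_ereal.simps(1) ereal_minus_le_minus)
  with r show "y \<le> l1 F \<mu> t x" by simp
qed

lemma l1_leI:
  assumes "\<And>V. open V \<Longrightarrow> x \<in> V \<Longrightarrow> ennreal (exp (- r)) \<le> Liminf F (pow_measure \<mu> t V)"
  shows "l1 F \<mu> t x \<le> ereal r"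
proof -
  have "ennreal (exp (- r)) \<le> (INF V\<in>{V. open V \<and> x \<in> V}. Liminf F (pow_measure \<mu> t V))"
    by (rule INF_greatest) (use assms in auto)
  then have "\<not> enn_ln (INF V\<in>{V. open V \<and> x \<in> V}. Liminf F (pow_measure \<mu> t V)) < ereal (- r)"
    by (simp add: enn_ln_less_iff not_less)
  then show ?thesis
    unfolding l1_def by (metis ereal_uminus_le_reorder not_less uminus_ereal.simps(1))
qed

text \<open>The lower bound for open sets holds with \<open>l1\<close> by construction,
  \<open>V\<close> being one of the neighbourhoods in the infimum.\<close>

lemma enn_exp_l1_le_Liminf:
  assumes "open V" "x \<in> V"
  shows "enn_exp (- l1 F \<mu> t x) \<le> Liminf F (pow_measure \<mu> t V)"
  unfolding l1_def using assms by (auto intro: INF_lower)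

text \<open>Union bound: the number of covering sets is a constant factor, absorbed by the gap
  between \<open>c\<close> and \<open>d\<close>.\<close>

lemma Limsup_pow_measure_cover_le:
  assumes D: "finite D" "Y \<subseteq> \<Union>D"
    and U: "\<And>U. U \<in> D \<Longrightarrow> open U"
      "\<And>U. U \<in> D \<Longrightarrow> \<forall>\<^sub>F i in F. emeasure (\<mu> i) U \<le> ennreal (exp (c / t i))"
    and cd: "c < d"
  shows "Limsup F (pow_measure \<mu> t Y) \<le> ennreal (exp d)"
proof (rule Limsup_pow_measure_le)
  have "\<forall>\<^sub>F i in F. \<forall>U\<in>D. emeasure (\<mu> i) U \<le> ennreal (exp (c / t i))"
    using D U by (simp add: eventually_ball_finite)
  then show "\<forall>\<^sub>F i in F. emeasure (\<mu> i) Y \<le> ennreal (exp (d / t i))"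
    using eventually_mult_exp_le[OF cd, of "real (card D)"]
  proof eventually_elim
    case (elim i)
    have s: "U \<in> D \<Longrightarrow> U \<in> sets (\<mu> i)" for U
      using U by (simp add: sets_eq)
    have "emeasure (\<mu> i) Y \<le> emeasure (\<mu> i) (\<Union>U\<in>D. U)"
      using D s by (intro emeasure_mono sets.finite_UN) auto
    also have "\<dots> \<le> (\<Sum>U\<in>D. emeasure (\<mu> i) U)"
      using D s by (intro emeasure_subadditive_finite) auto
    also have "\<dots> \<le> (\<Sum>U\<in>D. ennreal (exp (c / t i)))"
      using elim by (intro sum_mono) auto
    also have "\<dots> = ennreal (real (card D) * exp (c / t i))"
      by (simp add: ennreal_mult ennreal_of_nat_eq_real_of_nat)
    also have "\<dots> \<le> ennreal (exp (d / t i))"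
      using elim by (intro ennreal_leI) auto
    finally show ?case .
  qed
qed

end

section \<open>The rate function on the real line\<close>

lemma hfun_eq: "hfun l n x = l * min x 0 + n * max x 0"
  by (simp add: hfun_def)

lemma hfun_diag: "hfun l l = (\<lambda>x. l * x)"
  by (simp add: hfun_def fun_eq_iff)

lemma continuous_on_hfun: "continuous_on S (hfun l n)"
  unfolding hfun_eq[abs_def] by (intro continuous_intros)

text \<open>A supremum of functions of \<open>x\<close> that are continuous, or constant where
  \<open>Lambda\<close> is infinite.\<close>

lemma lower_semicont_conj: "lower_semicont (Lambda_S_conj F \<mu> t)"
proof -
  have "open {x. c < ereal (hfun l n x) - k}" for c k :: ereal and l n
  proof (cases k)
    case (real r)
    have "open {x. c < ereal (hfun l n x - r)}"
      by (intro open_Collect_less continuous_on_ereal continuous_intros continuous_on_hfun)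
    then show ?thesis using real by simp
  qed auto
  moreover have "{x. c < Lambda_S_conj F \<mu> t x} =
      (\<Union>(l, n)\<in>UNIV. {x. c < ereal (hfun l n x) - Lambda F \<mu> t (hfun l n)})" for c
    by (auto simp: Lambda_S_conj_def less_SUP_iff)
  ultimately show ?thesis
    by (auto simp: lower_semicont_def intro!: open_UN)
qed

lemma conj_on_le_Lambda_S_conj: "conj_on G (Lfun F \<mu> t) x \<le> Lambda_S_conj F \<mu> t x"
  unfolding conj_on_def
proof (rule SUP_least)
  fix l
  have "ereal (hfun l l x) - Lambda F \<mu> t (hfun l l) \<le> Lambda_S_conj F \<mu> t x"
    unfolding Lambda_S_conj_def by (rule SUP_upper2[of "(l, l)"]) auto
  then show "ereal (l * x) - Lfun F \<mu> t l \<le> Lambda_S_conj F \<mu> t x"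
    by (simp add: Lfun_def hfun_diag)
qed

section \<open>Convexity of \<open>L\<close> and the lower bound by tilting\<close>

locale real_measure_net = measure_net F \<mu> t
  for F :: "'i filter" and \<mu> :: "'i \<Rightarrow> real measure" and t +
  fixes G :: "real set"
  assumes Lambda_ex: "\<And>l n. Lambda_exists F \<mu> t (hfun l n)"
    and G_open: "open G" and G_interval: "is_interval G" and zero_in_G: "0 \<in> G"
    and L_finite: "\<And>l. l \<in> G \<Longrightarrow> \<bar>Lfun F \<mu> t l\<bar> \<noteq> \<infinity>"
begin

text \<open>Real-valued so that convexity and derivatives make sense; infinite values of
  \<open>Lfun\<close>, possible only outside \<open>G\<close>, become 0.\<close>

definition L :: "real \<Rightarrow> real" where
  "L l = real_of_ereal (Lfun F \<mu> t l)"

lemma Lfun_eq_L: "l \<in> G \<Longrightarrow> Lfun F \<mu> t l = ereal (L l)"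
  using L_finite by (simp add: L_def ereal_real')

lemma eventually_expint_less:
  assumes "l \<in> G" "L l < c"
  shows "\<forall>\<^sub>F i in F. expint (\<lambda>x. l * x) UNIV i < ennreal (exp (c / t i))"
  using Lambda_lessD[OF Lambda_ex[of l l], of c] assms Lfun_eq_L[of l]
  by (simp add: hfun_diag Lfun_def)

lemma eventually_less_expint:
  assumes "l \<in> G" "c < L l"
  shows "\<forall>\<^sub>F i in F. ennreal (exp (c / t i)) < expint (\<lambda>x. l * x) UNIV i"
  using less_LambdaD[OF Lambda_ex[of l l], of c] assms Lfun_eq_L[of l]
  by (simp add: hfun_diag Lfun_def)

text \<open>
  Instead of Hoelder's inequality: by convexity of the exponential function, the integrand for
  \<^term>\<open>u * l + v * m\<close>, normalised by \<^term>\<open>exp (- (u * a + v * b) / s)\<close>, is bounded by the convex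
  combination of the normalised integrands for \<^term>\<open>l\<close> and \<^term>\<open>m\<close>.
\<close>

lemma expint_convex_le:
  assumes uv: "0 \<le> u" "0 \<le> v" "u + v = 1"
    and l: "expint (\<lambda>x. l * x) UNIV i \<le> ennreal (exp (a / t i))"
    and m: "expint (\<lambda>x. m * x) UNIV i \<le> ennreal (exp (b / t i))"
  shows "expint (\<lambda>x. (u * l + v * m) * x) UNIV i \<le> ennreal (exp ((u * a + v * b) / t i))"
proof -
  define s where "s = t i"
  define A where "A = u * exp ((u * a + v * b - a) / s)"
  define B where "B = v * exp ((u * a + v * b - b) / s)"
  have AB: "0 \<le> A" "0 \<le> B"
    using uv by (auto simp: A_def B_def)
  have exp_le: "exp (u *\<^sub>R y + v *\<^sub>R z) \<le> u * exp y + v * exp z" for y z :: real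
    using exp_convex uv unfolding convex_on_def by blast
  have le: "exp ((u * l + v * m) * x / s) \<le> A * exp (l * x / s) + B * exp (m * x / s)" for x
  proof -
    have "(u * l + v * m) * x / s = (u * a + v * b) / s + (u * ((l * x - a) / s) + v * ((m * x - b) / s))"
      by (simp add: add_divide_distrib[symmetric] algebra_simps)
    then have "exp ((u * l + v * m) * x / s) =
        exp ((u * a + v * b) / s) * exp (u *\<^sub>R ((l * x - a) / s) + v *\<^sub>R ((m * x - b) / s))"
      by (simp add: exp_add)
    also have "\<dots> \<le> exp ((u * a + v * b) / s) * (u * exp ((l * x - a) / s) + v * exp ((m * x - b) / s))"
      by (intro mult_left_mono exp_le) simp
    also have "\<dots> = A * exp (l * x / s) + B * exp (m * x / s)"
      by (simp add: A_def B_def distrib_left diff_divide_distrib exp_diff mult_ac)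
    finally show ?thesis .
  qed
  have "expint (\<lambda>x. (u * l + v * m) * x) UNIV i
      \<le> (\<integral>\<^sup>+x. ennreal A * ennreal (exp (l * x / s)) + ennreal B * ennreal (exp (m * x / s)) \<partial>\<mu> i)"
    unfolding expint_def s_def[symmetric] using le AB
    by (intro nn_integral_mono) (simp add: ennreal_mult[symmetric] ennreal_plus[symmetric] ennreal_leI del: ennreal_plus)
  also have "\<dots> = ennreal A * expint (\<lambda>x. l * x) UNIV i + ennreal B * expint (\<lambda>x. m * x) UNIV i"
    unfolding expint_def s_def by (subst nn_integral_add) (auto simp: nn_integral_cmult)
  also have "\<dots> \<le> ennreal A * ennreal (exp (a / s)) + ennreal B * ennreal (exp (b / s))"
    using l m unfolding s_def by (intro add_mono mult_left_mono) auto
  also have "\<dots> = ennreal (A * exp (a / s) + B * exp (b / s))"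
    using AB by (simp add: ennreal_mult)
  \<comment> \<open>The weights \<open>A\<close> and \<open>B\<close> were chosen so that both terms
    carry the same exponential.\<close>
  also have "A * exp (a / s) + B * exp (b / s) = (u + v) * exp ((u * a + v * b) / s)"
    by (simp add: A_def B_def distrib_right mult.assoc exp_add[symmetric] add_divide_distrib[symmetric])
  finally show ?thesis
    using uv by (simp add: s_def)
qed

text \<open>The integral bound needs rates slightly above \<open>L l\<close> and \<open>L m\<close>;
  the slack \<open>e\<close> in both passes unchanged to the convex combination because
  \<open>u + v = 1\<close>.\<close>

lemma convex_on_L: "convex_on G L"
  unfolding convex_on_def
proof (intro conjI ballI allI impI)
  show cG: "convex G"
    using G_interval by (simp add: is_interval_convex_1)
  fix l m u v :: real
  assume lm: "l \<in> G" "m \<in> G" and uv: "0 \<le> u" "0 \<le> v" "u + v = 1"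
  define k where "k = u * l + v * m"
  have k: "k \<in> G"
    using convexD[OF cG lm uv] by (simp add: k_def)
  show "L (u *\<^sub>R l + v *\<^sub>R m) \<le> u * L l + v * L m"
  proof (rule field_le_epsilon)
    fix e :: real assume "0 < e"
    then have "\<forall>\<^sub>F i in F. expint (\<lambda>x. l * x) UNIV i < ennreal (exp ((L l + e) / t i))"
      "\<forall>\<^sub>F i in F. expint (\<lambda>x. m * x) UNIV i < ennreal (exp ((L m + e) / t i))"
      using lm by (auto intro!: eventually_expint_less)
    then have "\<forall>\<^sub>F i in F. expint (\<lambda>x. k * x) UNIV i
        \<le> ennreal (exp ((u * (L l + e) + v * (L m + e)) / t i))"
      unfolding k_def by eventually_elim (intro expint_convex_le uv less_imp_le)
    then have "Lfun F \<mu> t k \<le> ereal (u * (L l + e) + v * (L m + e))"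
      using Lambda_leI[OF Lambda_ex[of k k]] by (simp add: hfun_diag Lfun_def)
    also have "u * (L l + e) + v * (L m + e) = u * L l + v * L m + (u + v) * e"
      by (simp add: algebra_simps)
    finally show "L (u *\<^sub>R l + v *\<^sub>R m) \<le> u * L l + v * L m + e"
      using k uv by (simp add: Lfun_eq_L k_def)
  qed
qed

text \<open>
  Tilting: the two slope conditions say that the integral of \<^term>\<open>exp (q * y / s)\<close> over the
  complement of \<^term>\<open>ball x e\<close> is exponentially smaller than the full integral, so that the full
  integral is carried by the ball.
\<close>

lemma tilted_lower_bound:
  assumes G: "p \<in> G" "q \<in> G" "r \<in> G" and pqr: "p < q" "q < r"
    and right: "L r - L q < (r - q) * (x + e)" and left: "(q - p) * (x - e) < L q - L p"
    and b: "b < L q"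
  shows "ennreal (exp (b - q * x - \<bar>q\<bar> * e)) \<le> Liminf F (pow_measure \<mu> t (ball x e))"
proof (rule le_Liminf_pow_measure)
  \<comment> \<open>The last two entries are the exponential rates of the bounds for the right and
    the left tail. All three lie strictly below \<open>L q\<close>, which leaves room for
    \<open>d\<close> and \<open>d'\<close>.\<close>
  define m where "m = Max {b, L r - (r - q) * (x + e), L p + (q - p) * (x - e)}"
  have "m < L q"
    unfolding m_def using right left b by auto
  then obtain d d' where d: "m < d" "d < d'" "d' < L q"
    using dense by metis
  have m: "b \<le> m" "L r - (r - q) * (x + e) \<le> m" "L p + (q - p) * (x - e) \<le> m"
    by (auto simp: m_def)
  have "\<forall>\<^sub>F i in F. expint (\<lambda>y. r * y) UNIV i < ennreal (exp ((d + (r - q) * (x + e)) / t i))"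
    "\<forall>\<^sub>F i in F. expint (\<lambda>y. p * y) UNIV i < ennreal (exp ((d - (q - p) * (x - e)) / t i))"
    "\<forall>\<^sub>F i in F. ennreal (exp (d' / t i)) < expint (\<lambda>y. q * y) UNIV i"
    "\<forall>\<^sub>F i in F. 3 * exp (d / t i) \<le> exp (d' / t i)"
    using G m d by (auto intro!: eventually_expint_less eventually_less_expint eventually_mult_exp_le)
  then show "\<forall>\<^sub>F i in F. ennreal (exp ((b - q * x - \<bar>q\<bar> * e) / t i)) \<le> emeasure (\<mu> i) (ball x e)"
  proof eventually_elim
    case (elim i)
    define K where "K = exp (d / t i)"
    \<comment> \<open>Beyond \<open>x + e\<close>, the product \<open>(r - q) * y\<close> is at
      least \<open>(r - q) * (x + e)\<close>, so slope \<open>q\<close> can be traded for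
      \<open>r\<close>; the left tail uses \<open>p\<close> likewise.\<close>
    have "expint (\<lambda>y. q * y) {x + e..} i
        \<le> ennreal (exp (- ((r - q) * (x + e)) / t i)) * expint (\<lambda>y. r * y) {x + e..} i"
      using pqr mult_left_mono[of "x + e" _ "r - q"] by (intro expint_le) (auto simp: algebra_simps)
    also have "\<dots> \<le> ennreal (exp (- ((r - q) * (x + e)) / t i)) * ennreal (exp ((d + (r - q) * (x + e)) / t i))"
      using elim(1) order_trans[OF expint_mono_set[of _ UNIV]] by (intro mult_left_mono) (auto intro: less_imp_le)
    also have "\<dots> = ennreal K"
      by (simp add: K_def ennreal_mult[symmetric] exp_add[symmetric] add_divide_distrib diff_divide_distrib)
    finally have R: "expint (\<lambda>y. q * y) {x + e..} i \<le> ennreal K" .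
    have "expint (\<lambda>y. q * y) {..x - e} i
        \<le> ennreal (exp ((q - p) * (x - e) / t i)) * expint (\<lambda>y. p * y) {..x - e} i"
      using pqr mult_left_mono[of _ "x - e" "q - p"] by (intro expint_le) (auto simp: algebra_simps)
    also have "\<dots> \<le> ennreal (exp ((q - p) * (x - e) / t i)) * ennreal (exp ((d - (q - p) * (x - e)) / t i))"
      using elim(2) order_trans[OF expint_mono_set[of _ UNIV]] by (intro mult_left_mono) (auto intro: less_imp_le)
    also have "\<dots> = ennreal K"
      by (simp add: K_def ennreal_mult[symmetric] exp_add[symmetric] add_divide_distrib diff_divide_distrib)
    finally have P: "expint (\<lambda>y. q * y) {..x - e} i \<le> ennreal K" .
    \<comment> \<open>The full integral exceeds \<open>3 * K\<close> and the tails take at most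
      \<open>2 * K\<close>, so \<open>K\<close> remains for the ball.\<close>
    have "ennreal (3 * K) \<le> ennreal (exp (d' / t i))"
      using elim(4) by (intro ennreal_leI) (simp add: K_def)
    also have "\<dots> < expint (\<lambda>y. q * y) UNIV i"
      by (rule elim(3))
    also have "\<dots> \<le> expint (\<lambda>y. q * y) (ball x e \<union> ({x + e..} \<union> {..x - e})) i"
      by (intro expint_mono_set) (auto simp: dist_real_def)
    also have "\<dots> \<le> expint (\<lambda>y. q * y) (ball x e) i + expint (\<lambda>y. q * y) ({x + e..} \<union> {..x - e}) i"
      by (rule expint_Un_le) auto
    also have "\<dots> \<le> expint (\<lambda>y. q * y) (ball x e) i + (expint (\<lambda>y. q * y) {x + e..} i + expint (\<lambda>y. q * y) {..x - e} i)"
      by (intro add_left_mono expint_Un_le) auto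
    also have "\<dots> \<le> expint (\<lambda>y. q * y) (ball x e) i + (ennreal K + ennreal K)"
      by (intro add_left_mono add_mono R P)
    also have "ennreal K + ennreal K = ennreal (2 * K)"
      by (simp add: K_def ennreal_plus[symmetric] del: ennreal_plus)
    finally have "ennreal K \<le> expint (\<lambda>y. q * y) (ball x e) i"
      by (cases "expint (\<lambda>y. q * y) (ball x e) i")
         (auto simp: ennreal_plus[symmetric] ennreal_less_iff K_def simp del: ennreal_plus)
    \<comment> \<open>The tilt is removed: on the ball it is nearly constant, at most its value at
      \<open>x\<close> up to the error \<open>\<bar>q\<bar> * e\<close> in the exponent.\<close>
    also have "\<dots> \<le> ennreal (exp ((q * x + \<bar>q\<bar> * e) / t i)) * expint (\<lambda>_. 0) (ball x e) i"
    proof (rule expint_le)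
      fix y assume "y \<in> ball x e"
      then have "\<bar>q\<bar> * \<bar>y - x\<bar> \<le> \<bar>q\<bar> * e"
        by (intro mult_left_mono) (auto simp: dist_real_def)
      then show "q * y \<le> q * x + \<bar>q\<bar> * e + 0"
        using abs_ge_self[of "q * (y - x)"] unfolding abs_mult by (simp add: right_diff_distrib)
    qed auto
    finally have K: "ennreal K \<le> ennreal (exp ((q * x + \<bar>q\<bar> * e) / t i)) * emeasure (\<mu> i) (ball x e)"
      by (simp add: expint_zero)
    have "ennreal (exp ((b - q * x - \<bar>q\<bar> * e) / t i)) \<le> ennreal (exp (- (q * x + \<bar>q\<bar> * e) / t i)) * ennreal K"
      using m(1) d(1) t_pos[of i]
      by (auto simp: K_def ennreal_mult[symmetric] exp_add[symmetric] add_divide_distrib[symmetric]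
            intro!: ennreal_leI divide_right_mono)
    also have "\<dots> \<le> ennreal (exp (- (q * x + \<bar>q\<bar> * e) / t i)) *
        (ennreal (exp ((q * x + \<bar>q\<bar> * e) / t i)) * emeasure (\<mu> i) (ball x e))"
      by (intro mult_left_mono K) auto
    also have "\<dots> = emeasure (\<mu> i) (ball x e)"
      by (simp add: mult.assoc[symmetric] ennreal_mult[symmetric] exp_add[symmetric] add_divide_distrib[symmetric])
    finally show ?case .
  qed
qed

lemma l1_le_if_deriv:
  assumes a: "a \<in> G" and x: "x = left_deriv L a \<or> x = right_deriv L a"
  shows "l1 F \<mu> t x \<le> ereal (a * x - L a)"
proof (rule ereal_le_epsilon2)
  fix h :: real assume h: "0 < h"
  have "l1 F \<mu> t x \<le> ereal (a * x - L a + h)"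
  proof (rule l1_leI)
    fix V assume "open V" "x \<in> V"
    then obtain e0 where e0: "0 < e0" "ball x e0 \<subseteq> V"
      using openE by blast
    \<comment> \<open>The bound \<open>e0\<close> keeps the ball in \<open>V\<close>, the bound 1
      gives \<open>\<bar>q\<bar> \<le> \<bar>a\<bar> + 1\<close>, and the last one then makes
      \<open>\<bar>q\<bar> * e\<close> at most \<open>h / 2\<close>. The other half of
      \<open>h\<close> is spent on \<open>b = L q - h / 2\<close>.\<close>
    define e where "e = min (min e0 1) (h / 2 / (\<bar>a\<bar> + 1))"
    have e: "0 < e" "e \<le> e0" "e \<le> 1" "e \<le> h / 2 / (\<bar>a\<bar> + 1)"
      using e0 h by (auto simp: e_def)
    obtain p q r where pqr: "p \<in> G" "q \<in> G" "r \<in> G" "p < q" "q < r" "\<bar>q - a\<bar> < e"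
        "L a - a * x \<le> L q - q * x" "L r - L q < (r - q) * (x + e)" "(q - p) * (x - e) < L q - L p"
      using x convex_on_left_deriv_exposed[OF convex_on_L G_open a _ e(1), of x]
        convex_on_right_deriv_exposed[OF convex_on_L G_open a _ e(1), of x] by blast
    have "\<bar>q\<bar> * e \<le> (\<bar>a\<bar> + 1) * e"
      using pqr(6) e by (intro mult_right_mono) auto
    also have "\<dots> \<le> h / 2"
      using e(4) pos_le_divide_eq[of "\<bar>a\<bar> + 1" e "h / 2"] by (simp add: mult.commute)
    finally have "- (a * x - L a + h) \<le> (L q - h / 2) - q * x - \<bar>q\<bar> * e"
      using pqr(7) by simp
    then have "ennreal (exp (- (a * x - L a + h))) \<le> ennreal (exp ((L q - h / 2) - q * x - \<bar>q\<bar> * e))"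
      by (intro ennreal_leI) simp
    also have "\<dots> \<le> Liminf F (pow_measure \<mu> t (ball x e))"
      using pqr h by (intro tilted_lower_bound) auto
    also have "\<dots> \<le> Liminf F (pow_measure \<mu> t V)"
    proof (intro Liminf_mono eventuallyI)
      fix i
      have le: "emeasure (\<mu> i) (ball x e) \<le> emeasure (\<mu> i) V"
        using e0 e \<open>open V\<close> by (intro emeasure_mono) (auto simp: sets_eq)
      show "pow_measure \<mu> t (ball x e) i \<le> pow_measure \<mu> t V i"
        unfolding pow_measure_def by (rule enn_powr_mono[OF t_pos le])
    qed
    finally show "ennreal (exp (- (a * x - L a + h))) \<le> Liminf F (pow_measure \<mu> t V)" .
  qed
  then show "l1 F \<mu> t x \<le> ereal (a * x - L a) + ereal h"
    by simp
qed

section \<open>Comparison with \<open>l1\<close>, exponential tightness and the bound for closed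
  sets\<close>

lemma Lambda_S_conj_le_l1: "Lambda_S_conj F \<mu> t x \<le> l1 F \<mu> t x"
  unfolding Lambda_S_conj_def
  by (rule SUP_least) (auto intro!: conj_le_l1 Lambda_ex continuous_on_hfun)

lemma le_conj_on: "a \<in> G \<Longrightarrow> ereal (a * x - L a) \<le> conj_on G (Lfun F \<mu> t) x"
  unfolding conj_on_def by (rule SUP_upper2[of a]) (simp_all add: Lfun_eq_L)

text \<open>Since 0 is interior to \<open>G\<close>, some slopes \<open>d\<close> and
  \<open>- d\<close> have finite \<open>L\<close>; Chebyshev's inequality with them makes both tails
  decay at any prescribed rate.\<close>

lemma exponentially_tight:
  "\<exists>R. (\<forall>\<^sub>F i in F. emeasure (\<mu> i) {R<..} \<le> ennreal (exp (c / t i))) \<and>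
       (\<forall>\<^sub>F i in F. emeasure (\<mu> i) {..<- R} \<le> ennreal (exp (c / t i)))"
proof -
  obtain e where e: "0 < e" "ball 0 e \<subseteq> G"
    using G_open zero_in_G openE by blast
  define d where "d = e / 2"
  have d: "0 < d" "d \<in> G" "- d \<in> G"
    using e by (auto simp: d_def dist_real_def subset_iff)
  \<comment> \<open>Chosen so that \<open>d * R + c\<close> exceeds both \<open>L d\<close> and
    \<open>L (- d)\<close> by at least 1.\<close>
  define R where "R = (max (L d) (L (- d)) - c + 1) / d"
  have R: "L d < d * R + c" "L (- d) < d * R + c"
    using d by (auto simp: R_def)
  have "\<forall>\<^sub>F i in F. emeasure (\<mu> i) {x. d * R < k * x} \<le> ennreal (exp (c / t i))"
    if "k \<in> G" "L k < d * R + c" for k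
    using eventually_measure_superlevel_le[OF Lambda_ex[of k k], of "d * R" c] that Lfun_eq_L[of k]
    by (simp add: hfun_diag Lfun_def)
  from this[OF d(2) R(1)] this[OF d(3) R(2)]
  have "\<forall>\<^sub>F i in F. emeasure (\<mu> i) {x. d * R < d * x} \<le> ennreal (exp (c / t i))"
    "\<forall>\<^sub>F i in F. emeasure (\<mu> i) {x. d * R < - d * x} \<le> ennreal (exp (c / t i))"
    by blast+
  moreover have "{x. d * R < d * x} = {R<..}" "{x. d * R < - d * x} = {..<- R}"
    using d by (auto simp: mult_less_cancel_left_pos)
       (smt (verit, best) mult_less_cancel_left_pos mult_minus_right)+
  ultimately show ?thesis by auto
qed

lemma closed_upper_bound:
  assumes C: "closed C"
  shows "Limsup F (pow_measure \<mu> t C) \<le> (SUP x\<in>C. enn_exp (- Lambda_S_conj F \<mu> t x))"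
proof (rule dense_ge)
  fix Y assume "(SUP x\<in>C. enn_exp (- Lambda_S_conj F \<mu> t x)) < Y"
  then obtain d where d: "(SUP x\<in>C. enn_exp (- Lambda_S_conj F \<mu> t x)) < ennreal (exp d)" "ennreal (exp d) < Y"
    using ennreal_dense_exp by blast
  \<comment> \<open>The second threshold reserves a gap to \<open>d\<close> for the number of
    covering sets.\<close>
  obtain c where c: "(SUP x\<in>C. enn_exp (- Lambda_S_conj F \<mu> t x)) < ennreal (exp c)" "ennreal (exp c) < ennreal (exp d)"
    using ennreal_dense_exp d(1) by blast
  have cd: "c < d"
    using c(2) by (simp add: ennreal_less_iff)
  \<comment> \<open>These sets cover \<open>C\<close> by the local bound and include both tails, so
    compactness is needed only on \<open>C \<inter> {- R..R}\<close>.\<close>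
  define \<U> where "\<U> = {U. open U \<and> (\<forall>\<^sub>F i in F. emeasure (\<mu> i) U \<le> ennreal (exp (c / t i)))}"
  have cover: "\<exists>U\<in>\<U>. x \<in> U" if "x \<in> C" for x
  proof -
    have "enn_exp (- Lambda_S_conj F \<mu> t x) < ennreal (exp c)"
      by (rule le_less_trans[OF SUP_upper[OF that] c(1)])
    then have "ereal (- c) < Lambda_S_conj F \<mu> t x"
      unfolding enn_exp_less_iff by (cases "Lambda_S_conj F \<mu> t x") auto
    then obtain l n where "ereal (- c) < ereal (hfun l n x) - Lambda F \<mu> t (hfun l n)"
      unfolding Lambda_S_conj_def less_SUP_iff by auto
    from ex_open_measure_le[OF Lambda_ex continuous_on_hfun this] show ?thesis
      by (auto simp: \<U>_def)
  qed
  obtain R where R: "{R<..} \<in> \<U>" "{..<- R} \<in> \<U>"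
    using exponentially_tight[of c] by (auto simp: \<U>_def)
  have "compact (C \<inter> {- R..R})"
    using C by (simp add: closed_Int_compact)
  moreover have "C \<inter> {- R..R} \<subseteq> \<Union>\<U>"
    using cover by auto
  moreover have "\<And>U. U \<in> \<U> \<Longrightarrow> open U"
    by (simp add: \<U>_def)
  ultimately obtain D where D: "D \<subseteq> \<U>" "finite D" "C \<inter> {- R..R} \<subseteq> \<Union>D"
    by (rule compactE)
  have "Limsup F (pow_measure \<mu> t C) \<le> ennreal (exp d)"
  proof (rule Limsup_pow_measure_cover_le[OF _ _ _ _ cd])
    show "C \<subseteq> \<Union>(insert {R<..} (insert {..<- R} D))"
    proof
      fix x assume "x \<in> C"
      then have "x \<in> {R<..} \<or> x \<in> {..<- R} \<or> x \<in> C \<inter> {- R..R}"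
        by auto
      then show "x \<in> \<Union>(insert {R<..} (insert {..<- R} D))"
        using D(3) by blast
    qed
  qed (use D R in \<open>auto simp: \<U>_def\<close>)
  with d(2) show "Limsup F (pow_measure \<mu> t C) \<le> Y"
    by simp
qed

end

theorem corollary2:
  fixes F :: "'i filter"
    and \<mu> :: "'i \<Rightarrow> real measure"
    and t :: "'i \<Rightarrow> real"
    and G :: "real set"
  assumes "F \<noteq> bot"
    and "\<And>i. subprob_space (\<mu> i)"
    and "\<And>i. radon_measure (\<mu> i)"
    and "\<And>i. 0 < t i"
    and "(t \<longlongrightarrow> 0) F"
    and "\<And>l n. Lambda_exists F \<mu> t (hfun l n)"
    and "open G" and "is_interval G" and "0 \<in> G"
    and "\<And>l. l \<in> G \<Longrightarrow> \<bar>Lfun F \<mu> t l\<bar> \<noteq> \<infinity>"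
    and "Dom (Lambda_S_conj F \<mu> t) \<inter> {x. l1 F \<mu> t x > - Lfun F \<mu> t 0}
         \<subseteq> left_deriv (\<lambda>l. real_of_ereal (Lfun F \<mu> t l)) ` G
           \<union> right_deriv (\<lambda>l. real_of_ereal (Lfun F \<mu> t l)) ` G"
  shows "narrow_LDP F \<mu> t (Lambda_S_conj F \<mu> t) \<and>
         (\<forall>x \<in> Dom (Lambda_S_conj F \<mu> t). Lambda_S_conj F \<mu> t x = conj_on G (Lfun F \<mu> t) x)"
proof -
  interpret real_measure_net F \<mu> t G
    using assms by unfold_locales (auto simp: radon_measure_def)
  let ?J = "Lambda_S_conj F \<mu> t"
  have l1_le: "l1 F \<mu> t x \<le> conj_on G (Lfun F \<mu> t) x" if "x \<in> Dom ?J" for x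
  proof (cases "l1 F \<mu> t x > - Lfun F \<mu> t 0")
    case True
    with that assms(11) obtain a where "a \<in> G" "x = left_deriv L a \<or> x = right_deriv L a"
      unfolding L_def[abs_def] by blast
    then have "l1 F \<mu> t x \<le> ereal (a * x - L a)"
      by (intro l1_le_if_deriv)
    also have "\<dots> \<le> conj_on G (Lfun F \<mu> t) x"
      using \<open>a \<in> G\<close> by (rule le_conj_on)
    finally show ?thesis .
  next
    case False
    \<comment> \<open>The bound \<open>- L 0\<close> is the term of the conjugate at slope
      0.\<close>
    then have "l1 F \<mu> t x \<le> ereal (0 * x - L 0)"
      using Lfun_eq_L[OF zero_in_G] by simp
    also have "\<dots> \<le> conj_on G (Lfun F \<mu> t) x"
      using zero_in_G by (rule le_conj_on)
    finally show ?thesis .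
  qed
  \<comment> \<open>Three inequalities in a circle force equality.\<close>
  have l1_eq: "l1 F \<mu> t x = ?J x" "?J x = conj_on G (Lfun F \<mu> t) x" if "x \<in> Dom ?J" for x
    using l1_le[OF that] conj_on_le_Lambda_S_conj[of G F \<mu> t x] Lambda_S_conj_le_l1[of x] by auto
  have "0 \<le> ?J x" for x
  proof -
    \<comment> \<open>At slope 0 the integral is the total mass, at most 1; hence
      \<open>?J x\<close> is at least \<open>- L 0\<close>, which is nonnegative.\<close>
    have "Lfun F \<mu> t 0 \<le> ereal 0"
      unfolding Lfun_def
    proof (rule Lambda_leI[OF Lambda_ex], intro always_eventually allI)
      fix i
      show "expint (hfun 0 0) UNIV i \<le> ennreal (exp (0 / t i))"
        using subprob_space.subprob_emeasure_le_1[OF assms(2), of i UNIV]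
        by (simp add: hfun_diag expint_zero)
    qed
    then have "0 \<le> - L 0"
      using Lfun_eq_L[OF zero_in_G] by simp
    also have "ereal (- L 0) \<le> ?J x"
      using order_trans[OF le_conj_on[OF zero_in_G] conj_on_le_Lambda_S_conj] by simp
    finally show ?thesis by (simp add: zero_ereal_def)
  qed
  moreover have "(SUP x\<in>V. enn_exp (- ?J x)) \<le> Liminf F (pow_measure \<mu> t V)" if "open V" for V
  proof (rule SUP_least)
    fix x assume "x \<in> V"
    show "enn_exp (- ?J x) \<le> Liminf F (pow_measure \<mu> t V)"
    proof (cases "x \<in> Dom ?J")
      case True
      then show ?thesis
        using enn_exp_l1_le_Liminf[OF \<open>open V\<close> \<open>x \<in> V\<close>] l1_eq by simp
    next
      \<comment> \<open>Here \<open>?J x\<close> is infinite and the left side is 0.\<close>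
      case False
      then show ?thesis
        by (simp add: Dom_def enn_exp_def)
    qed
  qed
  ultimately show ?thesis
    unfolding narrow_LDP_def by (intro conjI allI ballI impI lower_semicont_conj closed_upper_bound l1_eq(2))
qed

end
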